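(* Given a convex quadratic optimization problem of the form $\min_{\mathbf l}\ \frac12\mathbf l^{\mathsf T}\mathbf Q(T)\mathbf l+\mathbf c(T)^{\mathsf T}\mathbf l$ in the parameters $\mathbf l=(l^i_\nu)_{i\in\mathcal U,\nu\in\mathcal V}$ of linear path-functional portfolios $\pi$ investing in a universe $\mathcal U$, adding the penalization $$+\frac{\beta}{T}\sum_{t=0}^{T-1}\sum_{i\in\mathcal U}\Big(\frac{\pi^i_{t+1}}{\mu^{\mathcal U,i}_{t+1}}-\frac{\pi^i_t}{\mu^{\mathcal U,i}_t}\Big)^2,$$ where $\beta\ge0$ is a hyperparameter, preserves the form of a convex quadratic optimization problem.
   Context: There are $d$ stocks with positive capitalizations $S^1,\dots,S^d$, observed at the times $t=0,1,\dots,T$ ($T\in\mathbb N$, $T\geq 1$). A universe is a subset $\mathcal U\subseteq\{1,\dots,d\}$ with universe weights $\mu^{\mathcal U,i}_t=S^i_t/\sum_{j\in\mathcal U}S^j_t>0$, $i\in\mathcal U$. A linear path-functional portfolio investing in $\mathcal U$, with auxiliary portfolio $\tau$ (weights summing to one and vanishing outside $\mathcal U$), has controlling functions $f^i(t,X_{[0,t]})=\sum_{\nu\in\mathcal V}l^i_\nu\phi^\nu(t,X_{[0,t]})$, $i\in\mathcal U$, with $\mathcal V$ a finite set, $\phi^\nu$ given real-valued non-anticipative functionals of the path of a process $X$ and constants $l^i_\nu\in\mathbb R$, and weights type I: $\pi^i_t=\tau^i_t\big(f^i(t,X_{[0,t]})+1-\sum_{j\in\mathcal U}\tau^j_tf^j(t,X_{[0,t]})\big)$,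 or type II: $\pi^i_t=f^i(t,X_{[0,t]})+\tau^i_t\big(1-\sum_{j\in\mathcal U}f^j(t,X_{[0,t]})\big)$. All quantities other than $\mathbf l$ ($S$, $\tau$, $X$, $\mathbf Q(T)$, $\mathbf c(T)$) are fixed, i.e. evaluated along one trajectory. "Convex quadratic optimization problem" means minimization of a convex polynomial of degree at most two in $\mathbf l$ (equivalently, up to an additive constant, $\frac12\mathbf l^{\mathsf T}A\mathbf l+b^{\mathsf T}\mathbf l$ with $A$ symmetric positive semidefinite). *)

theory Defs
  imports "HOL-Analysis.Analysis"
begin

text \<open>
  Stocks are numbered \<open>1, \<dots>, d\<close> and \<open>S t i\<close> is the capitalization of stock \<open>i\<close> at time \<open>t\<close>.
  A parameter vector in the Euclidean space indexed by \<open>I = U \<times> V\<close> is a function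
  \<open>l :: nat \<times> 'v \<Rightarrow> real\<close> of which only the coordinates in \<open>I\<close> are ever used.
\<close>

definition quad_objective ::
  "'k set \<Rightarrow> ('k \<Rightarrow> 'k \<Rightarrow> real) \<Rightarrow> ('k \<Rightarrow> real) \<Rightarrow> ('k \<Rightarrow> real) \<Rightarrow> real" where
  "quad_objective I Q c l =
     1 / 2 * (\<Sum>j\<in>I. \<Sum>k\<in>I. l j * Q j k * l k) + (\<Sum>k\<in>I. c k * l k)"

text \<open>
  Convexity is the inequality of \<^const>\<open>convex_on\<close>, written out coordinatewise because function
  types are not an instance of class \<^class>\<open>real_vector\<close>.
\<close>

definition convex_objective :: "(('k \<Rightarrow> real) \<Rightarrow> real) \<Rightarrow> bool" where
  "convex_objective F \<longleftrightarrow>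
     (\<forall>u. 0 \<le> u \<longrightarrow> u \<le> 1 \<longrightarrow> (\<forall>x y.
        F (\<lambda>k. (1 - u) * x k + u * y k) \<le> (1 - u) * F x + u * F y))"

text \<open>Convex polynomials of degree at most two in the variables indexed by \<open>I\<close>; the coefficient
  matrix is not required to be symmetric.\<close>

definition convex_quadratic :: "'k set \<Rightarrow> (('k \<Rightarrow> real) \<Rightarrow> real) \<Rightarrow> bool" where
  "convex_quadratic I F \<longleftrightarrow>
     (\<exists>A b a. \<forall>l. F l = quad_objective I A b l + a) \<and> convex_objective F"

definition sym_psd_on :: "'k set \<Rightarrow> ('k \<Rightarrow> 'k \<Rightarrow> real) \<Rightarrow> bool" where
  "sym_psd_on I A \<longleftrightarrow>
     (\<forall>j\<in>I. \<forall>k\<in>I. A j k = A k j) \<and> (\<forall>x. 0 \<le> (\<Sum>j\<in>I. \<Sum>k\<in>I. x j * A j k * x k))"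

definition universe_weight :: "(nat \<Rightarrow> nat \<Rightarrow> real) \<Rightarrow> nat set \<Rightarrow> nat \<Rightarrow> nat \<Rightarrow> real" where
  "universe_weight S U t i = S t i / (\<Sum>j\<in>U. S t j)"

text \<open>
  The time axis \<open>'t\<close> of the process \<open>X\<close> may be discrete (\<^typ>\<open>nat\<close>) or continuous (\<^typ>\<open>real\<close>).
  Non-anticipativity is built in: \<open>\<phi> \<nu>\<close> only receives the path restricted to the interval from
  \<open>0\<close> to the current time.
\<close>

definition control ::
  "'v set \<Rightarrow> ('v \<Rightarrow> 't \<Rightarrow> ('t \<Rightarrow> 'x) \<Rightarrow> real) \<Rightarrow> ('t::linordered_semidom \<Rightarrow> 'x)
     \<Rightarrow> (nat \<times> 'v \<Rightarrow> real) \<Rightarrow> nat \<Rightarrow> nat \<Rightarrow> real" where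
  "control V \<phi> X l t i =
     (\<Sum>\<nu>\<in>V. l (i, \<nu>) * \<phi> \<nu> (of_nat t) (restrict X {0..of_nat t}))"

datatype portfolio_type = Type_I | Type_II

text \<open>Weights at time \<open>t\<close> of the portfolio investing in \<open>U\<close> with controlling functions \<open>f t i\<close>,
  \<open>i \<in> U\<close>, and auxiliary portfolio \<open>\<tau>\<close>.\<close>

definition portfolio_weight ::
  "portfolio_type \<Rightarrow> nat set \<Rightarrow> (nat \<Rightarrow> nat \<Rightarrow> real) \<Rightarrow> (nat \<Rightarrow> nat \<Rightarrow> real)
     \<Rightarrow> nat \<Rightarrow> nat \<Rightarrow> real" where
  "portfolio_weight K U \<tau> f t i =
     (if i \<in> U then
        (case K of
           Type_I \<Rightarrow> \<tau> t i * (f t i + 1 - (\<Sum>j\<in>U. \<tau> t j * f t j))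
         | Type_II \<Rightarrow> f t i + \<tau> t i * (1 - (\<Sum>j\<in>U. f t j)))
      else 0)"

definition variation_penalty ::
  "real \<Rightarrow> nat \<Rightarrow> nat set \<Rightarrow> (nat \<Rightarrow> nat \<Rightarrow> real) \<Rightarrow> (nat \<Rightarrow> nat \<Rightarrow> real) \<Rightarrow> real" where
  "variation_penalty \<beta> T U \<mu> \<pi> =
     \<beta> / real T * (\<Sum>t=0..T-1. \<Sum>i\<in>U. (\<pi> (t + 1) i / \<mu> (t + 1) i - \<pi> t i / \<mu> t i)^2)"

end

theory Submission
  imports Defs
begin

text \<open>
  Both portfolio types have weights that are affine in \<open>l\<close>, so the penalty is a nonnegative
  combination of squares of affine functions, and each square \<open>(w \<bullet> l + a)\<^sup>2\<close> is a quadratic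
  polynomial with positive semidefinite matrix \<open>2 w w\<^sup>T\<close>. Quadratic polynomials with symmetric
  positive semidefinite matrix are closed under addition, and they are exactly the convex
  quadratic ones.
\<close>

definition affine_objective :: "'k set \<Rightarrow> (('k \<Rightarrow> real) \<Rightarrow> real) \<Rightarrow> bool" where
  "affine_objective I g \<longleftrightarrow> (\<exists>w a. \<forall>l. g l = (\<Sum>k\<in>I. w k * l k) + a)"

text \<open>Convexity is encoded in the coefficient matrix rather than as an inequality, so that
  closure under sums and nonnegative multiples can be checked on the matrices.\<close>

definition psd_quadratic :: "'k set \<Rightarrow> (('k \<Rightarrow> real) \<Rightarrow> real) \<Rightarrow> bool" where
  "psd_quadratic I F \<longleftrightarrow>
     (\<exists>A b a. sym_psd_on I A \<and> (\<forall>l. F l = quad_objective I A b l + a))"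

lemma affine_objective_const: "affine_objective I (\<lambda>l. a)"
  unfolding affine_objective_def by (rule exI[of _ "\<lambda>_. 0"]) simp

lemma affine_objective_coordinate:
  assumes "finite I" "k \<in> I"
  shows "affine_objective I (\<lambda>l. l k)"
  unfolding affine_objective_def
proof (intro exI allI)
  fix l :: "'a \<Rightarrow> real"
  have "(\<Sum>j\<in>I. (if k = j then 1 else 0) * l j) = (\<Sum>j\<in>I. if k = j then l j else 0)"
    by (rule sum.cong) auto
  also have "\<dots> = l k" using assms by simp
  finally show "l k = (\<Sum>j\<in>I. (if k = j then 1 else 0) * l j) + 0" by simp
qed

lemma affine_objective_add:
  assumes "affine_objective I g" "affine_objective I h"
  shows "affine_objective I (\<lambda>l. g l + h l)"
proof -
  obtain w a v b where "\<And>l. g l = (\<Sum>k\<in>I. w k * l k) + a" "\<And>l. h l = (\<Sum>k\<in>I. v k * l k) + b"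
    using assms unfolding affine_objective_def by blast
  then have "g l + h l = (\<Sum>k\<in>I. (w k + v k) * l k) + (a + b)" for l
    by (simp add: distrib_right sum.distrib)
  then show ?thesis
    unfolding affine_objective_def by (intro exI allI)
qed

lemma affine_objective_cmult:
  assumes "affine_objective I g"
  shows "affine_objective I (\<lambda>l. r * g l)"
proof -
  obtain w a where "\<And>l. g l = (\<Sum>k\<in>I. w k * l k) + a"
    using assms unfolding affine_objective_def by blast
  then have "r * g l = (\<Sum>k\<in>I. (r * w k) * l k) + r * a" for l
    by (simp add: distrib_left sum_distrib_left mult.assoc)
  then show ?thesis
    unfolding affine_objective_def by (intro exI allI)
qed

lemma affine_objective_diff:
  assumes "affine_objective I g" "affine_objective I h"
  shows "affine_objective I (\<lambda>l. g l - h l)"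
  using affine_objective_add[OF assms(1) affine_objective_cmult[OF assms(2), of "-1"]] by simp

lemma affine_objective_mult_const:
  assumes "affine_objective I g"
  shows "affine_objective I (\<lambda>l. g l * r)"
  using affine_objective_cmult[OF assms, of r] by (simp add: mult.commute)

lemma affine_objective_divide:
  assumes "affine_objective I g"
  shows "affine_objective I (\<lambda>l. g l / r)"
  using affine_objective_mult_const[OF assms, of "inverse r"] by (simp add: divide_inverse)

lemma affine_objective_sum:
  assumes "\<And>n. n \<in> N \<Longrightarrow> affine_objective I (g n)"
  shows "affine_objective I (\<lambda>l. \<Sum>n\<in>N. g n l)"
  using assms
  \<comment> \<open>A sum over an infinite set is 0 by convention, so this case falls under
    constants, like the empty sum.\<close>
  by (induction N rule: infinite_finite_induct)
     (auto intro: affine_objective_const affine_objective_add)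

lemma psd_quadratic_const: "psd_quadratic I (\<lambda>l. a)"
  unfolding psd_quadratic_def
  by (rule exI[of _ "\<lambda>_ _. 0"], rule exI[of _ "\<lambda>_. 0"])
     (simp add: sym_psd_on_def quad_objective_def)

lemma psd_quadratic_add:
  assumes "psd_quadratic I F" "psd_quadratic I G"
  shows "psd_quadratic I (\<lambda>l. F l + G l)"
proof -
  obtain A b a B c e where
    A: "sym_psd_on I A" "\<And>l. F l = quad_objective I A b l + a" and
    B: "sym_psd_on I B" "\<And>l. G l = quad_objective I B c l + e"
    using assms unfolding psd_quadratic_def by blast
  have form: "(\<Sum>j\<in>I. \<Sum>k\<in>I. x j * (A j k + B j k) * x k) =
      (\<Sum>j\<in>I. \<Sum>k\<in>I. x j * A j k * x k) + (\<Sum>j\<in>I. \<Sum>k\<in>I. x j * B j k * x k)" for x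
    by (simp add: distrib_left distrib_right sum.distrib)
  have "sym_psd_on I (\<lambda>j k. A j k + B j k)"
    using A(1) B(1) by (simp add: sym_psd_on_def form)
  moreover have "F l + G l =
      quad_objective I (\<lambda>j k. A j k + B j k) (\<lambda>k. b k + c k) l + (a + e)" for l
    by (simp add: A(2) B(2) quad_objective_def form distrib_left distrib_right sum.distrib)
  ultimately show ?thesis
    unfolding psd_quadratic_def by blast
qed

lemma psd_quadratic_cmult:
  assumes "psd_quadratic I F" "0 \<le> r"
  shows "psd_quadratic I (\<lambda>l. r * F l)"
proof -
  obtain A b a where
    A: "sym_psd_on I A" "\<And>l. F l = quad_objective I A b l + a"
    using assms(1) unfolding psd_quadratic_def by blast
  have form: "(\<Sum>j\<in>I. \<Sum>k\<in>I. x j * (r * A j k) * x k) =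
      r * (\<Sum>j\<in>I. \<Sum>k\<in>I. x j * A j k * x k)" for x
    by (simp add: sum_distrib_left algebra_simps)
  have "sym_psd_on I (\<lambda>j k. r * A j k)"
    using A(1) assms(2) by (simp add: sym_psd_on_def form)
  moreover have "r * F l = quad_objective I (\<lambda>j k. r * A j k) (\<lambda>k. r * b k) l + r * a" for l
  proof -
    have "(\<Sum>k\<in>I. r * b k * l k) = r * (\<Sum>k\<in>I. b k * l k)"
      by (simp add: sum_distrib_left mult.assoc)
    then show ?thesis
      by (simp add: A(2) quad_objective_def form distrib_left)
  qed
  ultimately show ?thesis
    unfolding psd_quadratic_def by blast
qed

lemma psd_quadratic_sum:
  assumes "\<And>n. n \<in> N \<Longrightarrow> psd_quadratic I (F n)"
  shows "psd_quadratic I (\<lambda>l. \<Sum>n\<in>N. F n l)"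
  using assms
  by (induction N rule: infinite_finite_induct)
     (auto intro: psd_quadratic_const psd_quadratic_add)

lemma psd_quadratic_square:
  assumes "affine_objective I g"
  shows "psd_quadratic I (\<lambda>l. (g l)\<^sup>2)"
proof -
  obtain w a where g: "\<And>l. g l = (\<Sum>k\<in>I. w k * l k) + a"
    using assms unfolding affine_objective_def by blast
  \<comment> \<open>The 2 in the matrix offsets the factor 1/2 in \<open>quad_objective\<close>. The
    cross term of the expanded square supplies the linear coefficients \<open>2 * a * w k\<close>
    below.\<close>
  have form: "(\<Sum>j\<in>I. \<Sum>k\<in>I. x j * (2 * w j * w k) * x k) = 2 * (\<Sum>k\<in>I. w k * x k)\<^sup>2" for x
    by (simp add: power2_eq_square sum_product sum_distrib_left algebra_simps)
  have "sym_psd_on I (\<lambda>j k. 2 * w j * w k)"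
    by (simp add: sym_psd_on_def form)
  moreover have "(g l)\<^sup>2 = quad_objective I (\<lambda>j k. 2 * w j * w k) (\<lambda>k. 2 * a * w k) l + a\<^sup>2" for l
  proof -
    have "(\<Sum>k\<in>I. 2 * a * w k * l k) = 2 * a * (\<Sum>k\<in>I. w k * l k)"
      by (simp add: sum_distrib_left mult.assoc)
    then show ?thesis
      by (simp add: g quad_objective_def form power2_sum)
  qed
  ultimately show ?thesis
    unfolding psd_quadratic_def by blast
qed

text \<open>For the quadratic form \<open>q\<close>, chord minus value is
  \<open>u * (1 - u) * q (x - y)\<close>, which is nonnegative by semidefiniteness; the affine part
  gives equality.\<close>

lemma convex_objective_quad:
  fixes I :: "'k set"
  assumes "sym_psd_on I A" and F: "\<And>l. F l = quad_objective I A b l + a"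
  shows "convex_objective F"
  unfolding convex_objective_def
proof (intro allI impI)
  fix u :: real and x y :: "'k \<Rightarrow> real"
  assume u: "0 \<le> u" "u \<le> 1"
  define q where "q x = (\<Sum>j\<in>I. \<Sum>k\<in>I. x j * A j k * x k)" for x
  have F_eq: "F l = 1/2 * q l + (\<Sum>k\<in>I. b k * l k) + a" for l
    by (simp add: F quad_objective_def q_def)
  define z where "z k = (1 - u) * x k + u * y k" for k
  \<comment> \<open>The identity already holds for each pair \<open>(j, k)\<close> separately, so it
    is enough to merge the double sums and compare summands.\<close>
  have "(1 - u) * q x + u * q y - u * (1 - u) * q (\<lambda>k. x k - y k) = q z"
    unfolding q_def z_def sum_distrib_left sum_subtractf[symmetric] sum.distrib[symmetric]
    by (intro sum.cong refl) algebra
  moreover have "0 \<le> u * (1 - u) * q (\<lambda>k. x k - y k)"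
    using u assms(1) by (simp add: q_def sym_psd_on_def)
  ultimately have q_le: "q z \<le> (1 - u) * q x + u * q y" by simp
  have L_eq: "(\<Sum>k\<in>I. b k * z k) = (1 - u) * (\<Sum>k\<in>I. b k * x k) + u * (\<Sum>k\<in>I. b k * y k)"
    unfolding z_def sum_distrib_left sum.distrib[symmetric]
    by (intro sum.cong refl) algebra
  have "F z \<le> 1/2 * ((1 - u) * q x + u * q y) +
      ((1 - u) * (\<Sum>k\<in>I. b k * x k) + u * (\<Sum>k\<in>I. b k * y k)) + a"
    unfolding F_eq L_eq using q_le by simp
  also have "\<dots> = (1 - u) * F x + u * F y"
    unfolding F_eq by (simp add: field_simps)
  finally have "F z \<le> (1 - u) * F x + u * F y" .
  then show "F (\<lambda>k. (1 - u) * x k + u * y k) \<le> (1 - u) * F x + u * F y"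
    by (simp add: z_def[abs_def])
qed

text \<open>Translates between the convexity inequality, used to state the problem, and the matrix
  condition, for which closure is proved. From left to right, the matrix is first symmetrized, and
  its semidefiniteness is then read off from convexity on segments centred at the origin.\<close>

lemma convex_quadratic_iff_psd_quadratic: "convex_quadratic I F \<longleftrightarrow> psd_quadratic I F"
proof
  assume "psd_quadratic I F"
  then show "convex_quadratic I F"
    unfolding psd_quadratic_def convex_quadratic_def using convex_objective_quad by blast
next
  assume "convex_quadratic I F"
  then obtain A b a where F: "\<And>l. F l = quad_objective I A b l + a" and conv: "convex_objective F"
    unfolding convex_quadratic_def by blast
  \<comment> \<open>The given \<open>A\<close> may be asymmetric; its symmetric part induces the
    same quadratic form, since swapping the two sums transposes the matrix.\<close>
  define B where "B j k = (A j k + A k j) / 2" for j k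
  have form: "(\<Sum>j\<in>I. \<Sum>k\<in>I. x j * B j k * x k) = (\<Sum>j\<in>I. \<Sum>k\<in>I. x j * A j k * x k)" for x
  proof -
    have "(\<Sum>j\<in>I. \<Sum>k\<in>I. x j * A k j * x k) = (\<Sum>j\<in>I. \<Sum>k\<in>I. x j * A j k * x k)"
      by (subst sum.swap) (simp add: mult_ac)
    moreover have "(\<Sum>j\<in>I. \<Sum>k\<in>I. x j * B j k * x k) =
        ((\<Sum>j\<in>I. \<Sum>k\<in>I. x j * A j k * x k) + (\<Sum>j\<in>I. \<Sum>k\<in>I. x j * A k j * x k)) / 2"
      unfolding sum.distrib[symmetric] sum_divide_distrib B_def
      by (intro sum.cong refl) (simp add: field_simps)
    ultimately show ?thesis by simp
  qed
  have "0 \<le> (\<Sum>j\<in>I. \<Sum>k\<in>I. x j * A j k * x k)" for x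
  proof -
    \<comment> \<open>The midpoint of \<open>x\<close> and \<open>- x\<close> is the origin, and the linear parts cancel.\<close>
    have "F (\<lambda>k. (1 - 1/2) * x k + 1/2 * (- x k)) \<le> (1 - 1/2) * F x + 1/2 * F (\<lambda>k. - x k)"
      using conv[unfolded convex_objective_def, rule_format, of "1/2" x "\<lambda>k. - x k"] by simp
    then have "F (\<lambda>_. 0) \<le> 1/2 * (F x + F (\<lambda>k. - x k))" by simp
    moreover have "F (\<lambda>_. 0) = a"
      by (simp add: F quad_objective_def)
    moreover have "F x + F (\<lambda>k. - x k) = (\<Sum>j\<in>I. \<Sum>k\<in>I. x j * A j k * x k) + 2 * a"
      by (simp add: F quad_objective_def sum_negf)
    ultimately show ?thesis by simp
  qed
  then have "sym_psd_on I B"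
    \<comment> \<open>\<open>B\<close> stays folded at first so that \<open>form\<close> can
      rewrite; unfolding it afterwards settles symmetry.\<close>
    by (simp add: sym_psd_on_def form) (simp add: B_def add.commute)
  moreover have "F l = quad_objective I B b l + a" for l
    by (simp add: F quad_objective_def form)
  ultimately show "psd_quadratic I F"
    unfolding psd_quadratic_def by blast
qed

text \<open>Along the fixed trajectory the values of \<phi> are constants, and
  \<open>i \<in> U\<close> places every \<open>(i, \<nu>)\<close> among the parameters.\<close>

lemma affine_objective_control:
  assumes "finite U" "finite V" "i \<in> U"
  shows "affine_objective (U \<times> V) (\<lambda>l. control V \<phi> X l t i)"
  unfolding control_def using assms
  by (auto intro!: affine_objective_sum affine_objective_mult_const affine_objective_coordinate)

text \<open>In both types the controls are multiplied only by \<tau>, which does not depend on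
  \<open>l\<close>, so no product of two controls arises.\<close>

lemma affine_objective_portfolio_weight:
  assumes "\<And>i. i \<in> U \<Longrightarrow> affine_objective I (\<lambda>l. f l t i)"
  shows "affine_objective I (\<lambda>l. portfolio_weight K U \<tau> (f l) t i)"
proof (cases "i \<in> U")
  case True
  then show ?thesis
    by (cases K)
       (auto simp: portfolio_weight_def intro!: assms affine_objective_cmult affine_objective_add
          affine_objective_diff affine_objective_sum affine_objective_const)
qed (simp add: portfolio_weight_def affine_objective_const)

text \<open>The weights \<mu> are constant in \<open>l\<close>, so each difference of ratios is
  affine; its squares are summed and scaled by the nonnegative
  \<open>\<beta> / real T\<close>.\<close>

lemma psd_quadratic_variation_penalty:
  assumes "\<And>t i. i \<in> U \<Longrightarrow> affine_objective I (\<lambda>l. \<pi> l t i)" "0 \<le> \<beta>"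
  shows "psd_quadratic I (\<lambda>l. variation_penalty \<beta> T U \<mu> (\<pi> l))"
  unfolding variation_penalty_def using assms
  by (intro psd_quadratic_cmult psd_quadratic_sum psd_quadratic_square
        affine_objective_diff affine_objective_divide) simp_all

theorem corollary7p5:
  fixes d T :: nat
    and S \<tau> :: "nat \<Rightarrow> nat \<Rightarrow> real"
    and U :: "nat set"
    and V :: "'v set"
    and \<phi> :: "'v \<Rightarrow> 't::linordered_semidom \<Rightarrow> ('t \<Rightarrow> 'x) \<Rightarrow> real"
    and X :: "'t \<Rightarrow> 'x"
    and K :: portfolio_type
    and Q :: "nat \<times> 'v \<Rightarrow> nat \<times> 'v \<Rightarrow> real"
    and c :: "nat \<times> 'v \<Rightarrow> real"
    and \<beta> :: real
  defines "penalized \<equiv> (\<lambda>l. quad_objective (U \<times> V) Q c l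
             + variation_penalty \<beta> T U (universe_weight S U)
                 (portfolio_weight K U \<tau> (control V \<phi> X l)))"
  assumes "1 \<le> T"
    and "\<And>t i. t \<le> T \<Longrightarrow> i \<in> {1..d} \<Longrightarrow> 0 < S t i"
    and "U \<subseteq> {1..d}"
    and "\<And>t. t \<le> T \<Longrightarrow> (\<Sum>i\<in>{1..d}. \<tau> t i) = 1"
    and "\<And>t i. t \<le> T \<Longrightarrow> i \<in> {1..d} - U \<Longrightarrow> \<tau> t i = 0"
    and "finite V"
    and "0 \<le> \<beta>"
    and "convex_quadratic (U \<times> V) (quad_objective (U \<times> V) Q c)"
  shows "convex_quadratic (U \<times> V) penalized \<and>
         (\<exists>A b a. sym_psd_on (U \<times> V) A \<and>
            (\<forall>l. penalized l = quad_objective (U \<times> V) A b l + a))"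
proof -
  have "finite U"
    using assms(4) finite_subset by blast
  then have "psd_quadratic (U \<times> V) penalized"
    unfolding penalized_def using assms(7-9)
    by (intro psd_quadratic_add psd_quadratic_variation_penalty affine_objective_portfolio_weight
          affine_objective_control) (simp_all add: convex_quadratic_iff_psd_quadratic)
  \<comment> \<open>The first conjunct is \<open>psd_quadratic\<close> by the equivalence, the
    second is its definition unfolded.\<close>
  then show ?thesis
    by (simp add: convex_quadratic_iff_psd_quadratic) (simp add: psd_quadratic_def)
qed

end
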